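(* Let $p,q\ge 1$ be integers and $n=pq$. Let $Z(p,q)$ denote the number of $n\times n$ permutation matrices $P$ such that the partial transpose $P^{\Gamma_p}$ is also a permutation matrix. Then \[ Z(p,q)=\sum \frac{(q!)^{2}}{\prod_{\pi\in S_p} a_{\pi}!\, b_{\pi}!}\ \prod_{i,j=1}^{p}\Bigl(\sum_{\pi\in S_p:\ \pi(i)=j} a_{\pi}\Bigr)!, \] where the outer sum runs over all families of nonnegative integers $(a_\pi)_{\pi\in S_p}$, $(b_\pi)_{\pi\in S_p}$ satisfying $\sum_{\pi\in S_p} a_\pi=\sum_{\pi\in S_p} b_\pi=q$ and, for every $i,j\in\{1,\dots,p\}$, $\sum_{\pi:\ \pi(i)=j} a_\pi=\sum_{\pi:\ \pi(i)=j} b_\pi$.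
   Context: A permutation matrix of size $n$ is an $n\times n$ matrix with entries in $\{0,1\}$ having exactly one $1$ in each row and each column. $S_p$ denotes the set of permutations of $\{1,\dots,p\}$. For an $n\times n$ matrix $M$ with $n=pq$, view $M$ as a $p\times p$ array of $q\times q$ blocks $\mathcal{B}_{i,j}$ ($1\le i,j\le p$). The partial transpose $M^{\Gamma_p}$ is the $n\times n$ matrix whose $(i,j)$ block is $\mathcal{B}_{i,j}^{T}$ (each block transposed independently, blocks kept in place). Equivalently, writing row/column indices as $(a-1)q+s$ with $a\in\{1,\dots,p\}$, $s\in\{1,\dots,q\}$, the entry of $M^{\Gamma_p}$ at $((a-1)q+s,(b-1)q+t)$ equals the entry of $M$ at $((a-1)q+t,(b-1)q+s)$. *)

theory Defs
  imports
    Complex_Main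
    "HOL-Library.FuncSet"
    "HOL-Combinatorics.Permutations"
    "Jordan_Normal_Form.Matrix"
begin

definition permutation_matrix :: "nat \<Rightarrow> 'a::zero_neq_one mat \<Rightarrow> bool" where
  "permutation_matrix n M \<longleftrightarrow>
     M \<in> carrier_mat n n \<and> elements_mat M \<subseteq> {0, 1} \<and>
     (\<forall>i<n. \<exists>!j. j < n \<and> M $$ (i, j) = 1) \<and>
     (\<forall>j<n. \<exists>!i. i < n \<and> M $$ (i, j) = 1)"

(* Matrix and block indices start at 0, as usual for the type mat, so the entry in position
   (s, t) of block (a, b) has index (a * q + s, b * q + t) in the full matrix. *)

definition mat_block :: "nat \<Rightarrow> 'a mat \<Rightarrow> nat \<Rightarrow> nat \<Rightarrow> 'a mat" where
  "mat_block q M a b = mat q q (\<lambda>(s, t). M $$ (a * q + s, b * q + t))"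

definition partial_transpose :: "nat \<Rightarrow> nat \<Rightarrow> 'a mat \<Rightarrow> 'a mat" where
  "partial_transpose p q M =
     mat (p * q) (p * q)
       (\<lambda>(i, j). transpose_mat (mat_block q M (i div q) (j div q)) $$ (i mod q, j mod q))"

lemma block_index_less:
  fixes a p q s :: nat
  assumes "a < p" "s < q"
  shows "a * q + s < p * q"
proof -
  have "a * q + s < Suc a * q" using assms(2) by simp
  also have "\<dots> \<le> p * q" using assms(1) by (intro mult_le_mono1) simp
  finally show ?thesis .
qed

lemma partial_transpose_index:
  assumes "a < p" "b < p" "s < q" "t < q"
  shows "partial_transpose p q M $$ (a * q + s, b * q + t) = M $$ (a * q + t, b * q + s)"
  using assms by (simp add: partial_transpose_def mat_block_def block_index_less)

lemma mat_block_partial_transpose: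
  assumes "a < p" "b < p"
  shows "mat_block q (partial_transpose p q M) a b = transpose_mat (mat_block q M a b)"
  by (rule eq_matI)
    (use assms in \<open>simp_all add: mat_block_def partial_transpose_index\<close>)

definition sym_perms :: "nat \<Rightarrow> (nat \<Rightarrow> nat) set" where
  "sym_perms p = {\<pi>. \<pi> permutes {1..p}}"

definition marginal :: "nat \<Rightarrow> ((nat \<Rightarrow> nat) \<Rightarrow> nat) \<Rightarrow> nat \<Rightarrow> nat \<Rightarrow> nat" where
  "marginal p a i j = (\<Sum>\<pi> \<in> {\<pi> \<in> sym_perms p. \<pi> i = j}. a \<pi>)"

(* The extensional function space makes each family indexed by the permutations of {1..p}
   occur exactly once, although functions on the whole type nat => nat are used. *)

definition admissible_families ::
    "nat \<Rightarrow> nat \<Rightarrow> (((nat \<Rightarrow> nat) \<Rightarrow> nat) \<times> ((nat \<Rightarrow> nat) \<Rightarrow> nat)) set" where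
  "admissible_families p q =
     {(a, b). a \<in> sym_perms p \<rightarrow>\<^sub>E UNIV \<and> b \<in> sym_perms p \<rightarrow>\<^sub>E UNIV \<and>
        (\<Sum>\<pi>\<in>sym_perms p. a \<pi>) = q \<and> (\<Sum>\<pi>\<in>sym_perms p. b \<pi>) = q \<and>
        (\<forall>i\<in>{1..p}. \<forall>j\<in>{1..p}. marginal p a i j = marginal p b i j)}"

(* Sums over infinite sets are 0 by convention; here the index sets are finite. *)

lemma finite_sym_perms: "finite (sym_perms p)"
  unfolding sym_perms_def by (rule finite_permutations) simp

lemma finite_admissible_families: "finite (admissible_families p q)"
proof (rule finite_subset)
  let ?F = "sym_perms p \<rightarrow>\<^sub>E {..q}"
  have "a \<in> ?F" if "a \<in> sym_perms p \<rightarrow>\<^sub>E UNIV" "(\<Sum>\<pi>\<in>sym_perms p. a \<pi>) = q" for a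
    using that member_le_sum[of _ "sym_perms p" a] finite_sym_perms
    by (auto simp: PiE_iff)
  then show "admissible_families p q \<subseteq> ?F \<times> ?F"
    unfolding admissible_families_def by auto
  show "finite (?F \<times> ?F)"
    by (intro finite_cartesian_product finite_PiE finite_sym_perms) auto
qed

end

theory Submission
  imports Defs "HOL-Combinatorics.Multiset_Permutations"
begin

text \<open>
  A permutation matrix \<open>P\<close> is a set \<open>E\<close> of quadruples \<open>((a, s), (b, t))\<close>, block row, row offset, block
  column, column offset, in which every \<open>(a, s)\<close> and every \<open>(b, t)\<close> occurs exactly once. The partial
  transpose of \<open>P\<close> is a permutation matrix iff also every \<open>(a, t)\<close> and every \<open>(b, s)\<close> occurs exactly
  once. Hence for fixed \<open>s\<close> the map \<open>a \<mapsto> b\<close> is a permutation \<open>f s\<close>, for fixed \<open>t\<close> it is a permutation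
  \<open>g t\<close>, and the entries 1 of block \<open>(i, j)\<close> are the graph of a bijection from \<open>{s. f s i = j}\<close> to
  \<open>{t. g t i = j}\<close>. Conversely \<open>f\<close>, \<open>g\<close> and such bijections determine \<open>P\<close>. Sorting the pairs \<open>(f, g)\<close>
  by the number of offsets at which each permutation is used gives two multinomial
  coefficients, and the bijections contribute the factorials of the marginals.
\<close>

subsection \<open>Counting maps with prescribed fibres\<close>

text \<open>Such a map sends each fibre of \<open>v\<close> injectively into the fibre of
  \<open>u\<close> over the same value. As these fibres have equal size, it is an arbitrary
  bijection between them, chosen independently for each value. The induction picks the image of one
  new point and removes it from \<open>B\<close>.\<close>

lemma card_inj_fibre_maps:
  assumes "finite A" "finite B" "finite C" "v ` A \<subseteq> C"
    and "\<And>c. c \<in> C \<Longrightarrow> card {x \<in> A. v x = c} = card {y \<in> B. u y = c}"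
  shows "card {\<tau> \<in> A \<rightarrow>\<^sub>E B. inj_on \<tau> A \<and> (\<forall>x\<in>A. u (\<tau> x) = v x)} =
    (\<Prod>c\<in>C. fact (card {x \<in> A. v x = c}))"
  using assms
proof (induction A arbitrary: B rule: finite_induct)
  case empty
  then show ?case by (simp add: PiE_empty_domain Collect_conv_if)
next
  case (insert x A)
  let ?M = "\<lambda>A B. {\<tau> \<in> A \<rightarrow>\<^sub>E B. inj_on \<tau> A \<and> (\<forall>x\<in>A. u (\<tau> x) = v x)}"
  let ?Y = "{y \<in> B. u y = v x}"
  let ?G = "\<lambda>y. (\<lambda>\<tau>. \<tau>(x := y)) ` ?M A (B - {y})"
  have vx: "v x \<in> C" and vA: "v ` A \<subseteq> C" using insert.prems by auto
  have fibre: "card {z \<in> insert x A. v z = c} =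
      (if c = v x then Suc (card {z \<in> A. v z = c}) else card {z \<in> A. v z = c})" for c
  proof -
    have "{z \<in> insert x A. v z = c} = (if c = v x then insert x {z \<in> A. v z = c} else {z \<in> A. v z = c})"
      by auto
    then show ?thesis using insert.hyps by simp
  qed
  \<comment> \<open>Removing \<open>y\<close> shrinks only the fibre of \<open>u\<close> over
    \<open>v x\<close>, by one, just as removing \<open>x\<close> shrinks the fibre of
    \<open>v\<close>; so the hypothesis on fibre sizes survives for the smaller sets.\<close>
  have IH: "card (?M A (B - {y})) = (\<Prod>c\<in>C. fact (card {z \<in> A. v z = c}))" if y: "y \<in> ?Y" for y
  proof (rule insert.IH)
    fix c assume c: "c \<in> C"
    have "{z \<in> B - {y}. u z = c} = {z \<in> B. u z = c} - {y}" by auto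
    moreover have "y \<in> {z \<in> B. u z = c} \<longleftrightarrow> c = v x" using y by auto
    ultimately have "card {z \<in> B - {y}. u z = c} =
        (if c = v x then card {z \<in> B. u z = c} - 1 else card {z \<in> B. u z = c})"
      using insert.prems(1) by (simp add: card_Diff_singleton_if)
    then show "card {z \<in> A. v z = c} = card {z \<in> B - {y}. u z = c}"
      using insert.prems(4)[OF c] fibre[of c] by (simp split: if_splits)
  qed (use insert.prems vA in auto)
  have split: "?M (insert x A) B = (\<Union>y\<in>?Y. ?G y)"
  proof (intro equalityI subsetI)
    fix \<tau> assume \<tau>: "\<tau> \<in> ?M (insert x A) B"
    \<comment> \<open>Resetting \<open>x\<close> to \<open>undefined\<close> makes the map
      extensional on \<open>A\<close>.\<close>
    have "\<tau>(x := undefined) \<in> ?M A (B - {\<tau> x})"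
      using \<tau> insert.hyps(2) by (auto simp: PiE_iff inj_on_def extensional_def)
    moreover have "\<tau> = (\<tau>(x := undefined))(x := \<tau> x)" by simp
    ultimately have "\<tau> \<in> ?G (\<tau> x)" by blast
    moreover have "\<tau> x \<in> ?Y" using \<tau> by auto
    ultimately show "\<tau> \<in> (\<Union>y\<in>?Y. ?G y)" by blast
  next
    fix \<tau> assume "\<tau> \<in> (\<Union>y\<in>?Y. ?G y)"
    then obtain y \<rho> where "y \<in> ?Y" "\<rho> \<in> ?M A (B - {y})" "\<tau> = \<rho>(x := y)" by blast
    then show "\<tau> \<in> ?M (insert x A) B"
      using insert.hyps(2) by (auto simp: PiE_iff inj_on_def extensional_def)
  qed
  have fin: "finite (?M A B')" if "finite B'" for B'
    using that insert.hyps(1) by (intro finite_subset[OF _ finite_PiE[of A "\<lambda>_. B'"]]) auto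
  have "card (\<Union>y\<in>?Y. ?G y) = (\<Sum>y\<in>?Y. card (?G y))"
  proof (rule card_UN_disjoint)
    show "\<forall>i\<in>?Y. \<forall>j\<in>?Y. i \<noteq> j \<longrightarrow> ?G i \<inter> ?G j = {}"
      by (auto dest: fun_cong[of _ _ x])
  qed (use insert.prems fin in auto)
  also have "\<dots> = (\<Sum>y\<in>?Y. card (?M A (B - {y})))"
  proof (intro sum.cong refl card_image inj_onI)
    fix y \<rho> \<rho>' assume "\<rho> \<in> ?M A (B - {y})" "\<rho>' \<in> ?M A (B - {y})" and eq: "\<rho>(x := y) = \<rho>'(x := y)"
    then have "\<rho> x = \<rho>' x" using insert.hyps(2) by (auto simp: PiE_iff extensional_def)
    then show "\<rho> = \<rho>'" using eq by (metis fun_upd_triv fun_upd_upd)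
  qed
  also have "\<dots> = card ?Y * (\<Prod>c\<in>C. fact (card {z \<in> A. v z = c}))"
    using IH by simp
  \<comment> \<open>If \<open>k\<close> old points lie over \<open>v x\<close>, the new point has
    \<open>Suc k\<close> possible images; this turns the factor \<open>fact k\<close> into
    \<open>fact (Suc k)\<close> and leaves the other factors alone.\<close>
  also have "card ?Y = Suc (card {z \<in> A. v z = v x})"
    using insert.prems(4)[OF vx] fibre[of "v x"] by simp
  also have "\<dots> * (\<Prod>c\<in>C. fact (card {z \<in> A. v z = c})) =
      (\<Prod>c\<in>C. fact (card {z \<in> insert x A. v z = c}))"
  proof -
    have "(\<Prod>c\<in>C - {v x}. fact (card {z \<in> insert x A. v z = c}) :: nat) =
        (\<Prod>c\<in>C - {v x}. fact (card {z \<in> A. v z = c}))"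
      unfolding fibre by (intro prod.cong) auto
    then show ?thesis
      unfolding prod.remove[OF insert.prems(2) vx] fibre[of "v x"] by (simp add: algebra_simps)
  qed
  finally show ?case unfolding split .
qed

text \<open>A map on \<open>{..<q}\<close> is a word of length \<open>q\<close>, and prescribing its
  fibre sizes means prescribing its multiset of letters. The count is therefore the number of
  arrangements of a multiset, a multinomial coefficient.\<close>

lemma card_maps_with_fibre_sizes:
  assumes S: "finite S" and a: "(\<Sum>x\<in>S. a x) = q"
  shows "real (card {f \<in> {..<q} \<rightarrow>\<^sub>E S. \<forall>x\<in>S. card {s \<in> {..<q}. f s = x} = a x}) =
    fact q / (\<Prod>x\<in>S. fact (a x))"
proof -
  let ?F = "{f \<in> {..<q} \<rightarrow>\<^sub>E S. \<forall>x\<in>S. card {s \<in> {..<q}. f s = x} = a x}"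
  define M where "M = (\<Sum>x\<in>S. replicate_mset (a x) x)"
  have count_M: "count M x = (if x \<in> S then a x else 0)" for x
    using S by (simp add: M_def count_sum if_distrib sum.delta' cong: if_cong)
  have size_M: "size M = q"
    using a by (simp add: M_def size_multiset_sum)
  have set_M: "set_mset M \<subseteq> S"
    using count_M by (auto simp flip: count_greater_zero_iff split: if_splits)
  have count_map: "count (mset (map f [0..<q])) x = card {s \<in> {..<q}. f s = x}" for f and x :: 'a
    by (simp only: count_mset count_list_eq_length_filter length_filter_conv_card)
      (auto intro!: arg_cong[of _ _ card])
  have "bij_betw (\<lambda>f. map f [0..<q]) ?F (permutations_of_multiset M)"
  proof (rule bij_betw_imageI)
    show "inj_on (\<lambda>f. map f [0..<q]) ?F"
    proof (rule inj_onI)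
      fix f g assume "f \<in> ?F" "g \<in> ?F" and eq: "map f [0..<q] = map g [0..<q]"
      then have "f \<in> {..<q} \<rightarrow>\<^sub>E S" "g \<in> {..<q} \<rightarrow>\<^sub>E S" by blast+
      then show "f = g" by (rule PiE_ext) (use eq in simp)
    qed
    show "(\<lambda>f. map f [0..<q]) ` ?F = permutations_of_multiset M"
    proof (intro equalityI subsetI)
      fix xs assume "xs \<in> (\<lambda>f. map f [0..<q]) ` ?F"
      then obtain f where f: "f \<in> ?F" "xs = map f [0..<q]" by blast
      have "count (mset xs) x = count M x" for x
      proof (cases "x \<in> S")
        case True
        then show ?thesis using f by (simp only: f(2) count_map count_M) auto
      next
        case False
        then have "{s \<in> {..<q}. f s = x} = {}" using f(1) by auto
        then show ?thesis using False by (simp only: f(2) count_map count_M) auto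
      qed
      then show "xs \<in> permutations_of_multiset M"
        by (simp add: permutations_of_multiset_def multiset_eq_iff)
    next
      fix xs assume "xs \<in> permutations_of_multiset M"
      then have xs: "mset xs = M" by (simp add: permutations_of_multiset_def)
      define f where "f = restrict (\<lambda>i. xs ! i) {..<q}"
      have len: "length xs = q" using xs size_M by auto
      have map: "map f [0..<q] = xs" by (rule nth_equalityI) (auto simp: f_def len)
      have "f \<in> {..<q} \<rightarrow>\<^sub>E S" using set_M xs len by (auto simp: f_def)
      moreover have "card {s \<in> {..<q}. f s = x} = a x" if "x \<in> S" for x
        unfolding count_map[symmetric] map xs using count_M that by simp
      ultimately show "xs \<in> (\<lambda>f. map f [0..<q]) ` ?F"
        using map by (intro image_eqI[of _ _ f]) auto
    qed
  qed
  then have "card ?F = card (permutations_of_multiset M)" by (rule bij_betw_same_card)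
  moreover have "fact q = card (permutations_of_multiset M) * (\<Prod>x\<in>set_mset M. fact (count M x))"
    using card_permutations_of_multiset_aux[of M] size_M by (simp add: mult.commute)
  \<comment> \<open>Elements of \<open>S\<close> with multiplicity 0 are missing from
    \<open>set_mset M\<close>, but their factor is \<open>fact 0 = 1\<close>.\<close>
  moreover have "(\<Prod>x\<in>set_mset M. fact (count M x)) = (\<Prod>x\<in>S. fact (a x) :: nat)"
    using S set_M by (intro prod.mono_neutral_cong_left) (auto simp: count_M not_in_iff split: if_splits)
  ultimately have "card ?F * (\<Prod>x\<in>S. fact (a x)) = fact q" by simp
  then have "real (card ?F * (\<Prod>x\<in>S. fact (a x))) = real (fact q)" by (simp only:)
  then have "real (card ?F) * (\<Prod>x\<in>S. fact (a x)) = fact q" by simp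
  moreover have "(\<Prod>x\<in>S. fact (a x) :: real) \<noteq> 0" using S by simp
  ultimately show ?thesis by (simp add: field_simps)
qed

subsection \<open>Matrices as sets of positions\<close>

text \<open>Blocks are numbered from 1, to match the domain of the permutations, offsets from 0.\<close>

definition cells :: "nat \<Rightarrow> nat \<Rightarrow> (nat \<times> nat) set" where
  "cells p q = {1..p} \<times> {..<q}"

definition cell_index :: "nat \<Rightarrow> nat \<times> nat \<Rightarrow> nat" where
  "cell_index q = (\<lambda>(a, s). (a - 1) * q + s)"

text \<open>The graph of a permutation of \<open>A\<close>. It is kept as a relation because
  \<open>swap_offsets\<close> acts on its pairs and may destroy functionality.\<close>

definition matching_on :: "'a set \<Rightarrow> ('a \<times> 'a) set \<Rightarrow> bool" where
  "matching_on A E \<longleftrightarrow> E \<subseteq> A \<times> A \<and> (\<forall>x\<in>A. \<exists>!y. (x, y) \<in> E) \<and> (\<forall>y\<in>A. \<exists>!x. (x, y) \<in> E)"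

text \<open>The partial transpose, seen on the set of positions of the ones.\<close>

definition swap_offsets :: "(('a \<times> 'b) \<times> ('a \<times> 'b)) set \<Rightarrow> (('a \<times> 'b) \<times> ('a \<times> 'b)) set" where
  "swap_offsets E = {((a, t), (b, s)) | a s b t. ((a, s), (b, t)) \<in> E}"

definition mat_support :: "nat \<Rightarrow> nat \<Rightarrow> 'a::one mat \<Rightarrow> ((nat \<times> nat) \<times> (nat \<times> nat)) set" where
  "mat_support p q M =
     {(x, y) \<in> cells p q \<times> cells p q. M $$ (cell_index q x, cell_index q y) = 1}"

lemma matching_on_subset: "matching_on A E \<Longrightarrow> E \<subseteq> A \<times> A"
  by (simp add: matching_on_def)

lemma matching_on_mem:
  assumes "matching_on A E" "(x, y) \<in> E"
  shows "x \<in> A" "y \<in> A"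
  using matching_on_subset[OF assms(1)] assms(2) by auto

lemma matching_on_row: "matching_on A E \<Longrightarrow> x \<in> A \<Longrightarrow> \<exists>y. (x, y) \<in> E"
  unfolding matching_on_def by (blast elim: ex1E)

lemma matching_on_right_unique:
  assumes "matching_on A E" "(x, y) \<in> E" "(x, z) \<in> E"
  shows "y = z"
proof -
  have *: "\<exists>!y. (x, y) \<in> E" using assms matching_on_mem(1)[OF assms(1,2)] by (simp add: matching_on_def)
  show ?thesis using the1_equality[OF * assms(2)] the1_equality[OF * assms(3)] by simp
qed

lemma matching_on_left_unique:
  assumes "matching_on A E" "(x, z) \<in> E" "(y, z) \<in> E"
  shows "x = y"
proof -
  have *: "\<exists>!x. (x, z) \<in> E" using assms matching_on_mem(2)[OF assms(1,2)] by (simp add: matching_on_def)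
  show ?thesis using the1_equality[OF * assms(2)] the1_equality[OF * assms(3)] by simp
qed

lemma in_cells [simp]: "(a, s) \<in> cells p q \<longleftrightarrow> 1 \<le> a \<and> a \<le> p \<and> s < q"
  by (auto simp: cells_def)

lemma finite_cells: "finite (cells p q)"
  by (simp add: cells_def)

lemma in_swap_offsets [simp]: "((a, t), (b, s)) \<in> swap_offsets E \<longleftrightarrow> ((a, s), (b, t)) \<in> E"
  by (auto simp: swap_offsets_def)

lemma swap_offsets_swap_offsets: "swap_offsets (swap_offsets E) = E"
  by (auto simp: swap_offsets_def)

section \<open>From permutation matrices to matchings of cells\<close>

lemma bij_betw_cell_index: "bij_betw (cell_index q) (cells p q) {..<p * q}"
proof (rule bij_betwI[of _ _ _ "\<lambda>i. (i div q + 1, i mod q)"])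
  show "cell_index q \<in> cells p q \<rightarrow> {..<p * q}"
    using block_index_less[of "_ - 1" p _ q] by (auto simp: cell_index_def cells_def)
  show "(\<lambda>i. (i div q + 1, i mod q)) \<in> {..<p * q} \<rightarrow> cells p q"
  proof
    fix i assume "i \<in> {..<p * q}"
    \<comment> \<open>An index below \<open>p * q\<close> exists only for positive \<open>q\<close>,
      which is what bounds the remainder by \<open>q\<close>.\<close>
    then have "i < p * q" "0 < q" by (auto intro: Nat.gr0I)
    then show "(i div q + 1, i mod q) \<in> cells p q"
      by (auto simp: less_mult_imp_div_less Suc_le_eq)
  qed
qed (auto simp: cell_index_def cells_def)

text \<open>Carries the uniqueness conditions on rows and columns from matrix indices over to
  cells.\<close>

lemma bij_betw_ex1_iff:
  assumes "bij_betw r A B"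
  shows "(\<exists>!y. y \<in> B \<and> Q y) \<longleftrightarrow> (\<exists>!x. x \<in> A \<and> Q (r x))"
proof
  assume "\<exists>!y. y \<in> B \<and> Q y"
  then obtain y where y: "y \<in> B \<and> Q y" and uniq: "\<forall>z. z \<in> B \<and> Q z \<longrightarrow> z = y"
    by (rule ex1E)
  obtain x where x: "x \<in> A" "y = r x"
    using assms y by (auto simp: bij_betw_def)
  show "\<exists>!x. x \<in> A \<and> Q (r x)"
  proof (rule ex1I)
    show "x \<in> A \<and> Q (r x)" using x y by simp
    fix z assume z: "z \<in> A \<and> Q (r z)"
    then have "r z = r x" using uniq x(2) bij_betw_apply[OF assms, of z] by simp
    then show "z = x" using z x(1) inj_onD[OF bij_betw_imp_inj_on[OF assms]] by simp
  qed
next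
  assume "\<exists>!x. x \<in> A \<and> Q (r x)"
  then obtain x where x: "x \<in> A \<and> Q (r x)" and uniq: "\<forall>z. z \<in> A \<and> Q (r z) \<longrightarrow> z = x"
    by (rule ex1E)
  show "\<exists>!y. y \<in> B \<and> Q y"
  proof (rule ex1I)
    show "r x \<in> B \<and> Q (r x)" using x bij_betw_apply[OF assms] by simp
    fix y assume y: "y \<in> B \<and> Q y"
    then obtain z where "z \<in> A" "y = r z" using assms by (auto simp: bij_betw_def)
    moreover from this have "z = x" using uniq y by blast
    ultimately show "y = r x" by simp
  qed
qed

lemma permutation_matrix_iff_matching_on:
  assumes "M \<in> carrier_mat (p * q) (p * q)" "elements_mat M \<subseteq> {0, 1}"
  shows "permutation_matrix (p * q) M \<longleftrightarrow> matching_on (cells p q) (mat_support p q M)"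
proof -
  let ?r = "cell_index q" and ?A = "cells p q"
  have im: "?r ` ?A = {..<p * q}" and inj: "inj_on ?r ?A"
    using bij_betw_cell_index by (auto simp: bij_betw_def)
  have all: "(\<forall>i<p * q. Q i) \<longleftrightarrow> (\<forall>x\<in>?A. Q (?r x))" for Q
  proof -
    have "(\<forall>i<p * q. Q i) \<longleftrightarrow> (\<forall>i\<in>?r ` ?A. Q i)" unfolding im by auto
    then show ?thesis by simp
  qed
  have ex1: "(\<exists>!i. i < p * q \<and> Q i) \<longleftrightarrow> (\<exists>!x. x \<in> ?A \<and> Q (?r x))" for Q
    using bij_betw_ex1_iff[OF bij_betw_cell_index, where Q = Q] by simp
  have sub: "mat_support p q M \<subseteq> ?A \<times> ?A"
    by (auto simp: mat_support_def)
  have row: "(\<exists>!y. y \<in> ?A \<and> M $$ (?r x, ?r y) = 1) \<longleftrightarrow> (\<exists>!y. (x, y) \<in> mat_support p q M)"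
    and col: "(\<exists>!y. y \<in> ?A \<and> M $$ (?r y, ?r x) = 1) \<longleftrightarrow> (\<exists>!y. (y, x) \<in> mat_support p q M)"
    if "x \<in> ?A" for x
    using that by (simp_all add: mat_support_def)
  show ?thesis
    unfolding permutation_matrix_def matching_on_def all ex1
    using assms sub row col by simp
qed

lemma elements_mat_subset_iff:
  assumes "M \<in> carrier_mat m n"
  shows "elements_mat M \<subseteq> S \<longleftrightarrow> (\<forall>i<m. \<forall>j<n. M $$ (i, j) \<in> S)"
  using assms by (auto simp: subset_iff dest!: elements_matD)

lemma mat_support_partial_transpose:
  "mat_support p q (partial_transpose p q M) = swap_offsets (mat_support p q M)"
proof -
  have "((a, s), (b, t)) \<in> mat_support p q (partial_transpose p q M) \<longleftrightarrow>
        ((a, s), (b, t)) \<in> swap_offsets (mat_support p q M)" for a s b t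
    \<comment> \<open>The index rule numbers blocks from 0 and the cells number them from 1, hence
      the shift.\<close>
    using partial_transpose_index[of "a - 1" p "b - 1" s q t M]
    by (auto simp: mat_support_def cell_index_def)
  then show ?thesis by auto
qed

lemma partial_transpose_carrier: "partial_transpose p q M \<in> carrier_mat (p * q) (p * q)"
  by (simp add: partial_transpose_def)

text \<open>A 0-1 matrix is the indicator function of its set of ones. Injectivity uses that no
  other entries occur; surjectivity comes from writing down the indicator matrix of a given
  set.\<close>

lemma bij_betw_mat_support:
  "bij_betw (mat_support p q)
     {M :: 'a::zero_neq_one mat. M \<in> carrier_mat (p * q) (p * q) \<and> elements_mat M \<subseteq> {0, 1}}
     (Pow (cells p q \<times> cells p q))"
proof (rule bij_betw_imageI)
  let ?r = "cell_index q" and ?A = "cells p q" and ?n = "p * q"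
  let ?D = "{M :: 'a mat. M \<in> carrier_mat ?n ?n \<and> elements_mat M \<subseteq> {0, 1}}"
  have im: "?r ` ?A = {..<?n}" and inj: "inj_on ?r ?A"
    using bij_betw_cell_index by (auto simp: bij_betw_def)
  show "inj_on (mat_support p q) ?D"
  proof (rule inj_onI, rule eq_matI)
    fix M N :: "'a mat" and i j
    assume M: "M \<in> ?D" and N: "N \<in> ?D" and eq: "mat_support p q M = mat_support p q N"
      and "i < dim_row N" "j < dim_col N"
    then have ij: "i < ?n" "j < ?n" by auto
    then have "i \<in> ?r ` ?A" "j \<in> ?r ` ?A" by (simp_all add: im)
    then obtain x y where xy: "x \<in> ?A" "y \<in> ?A" "i = ?r x" "j = ?r y" by blast
    have "(x, y) \<in> mat_support p q M \<longleftrightarrow> (x, y) \<in> mat_support p q N" using eq by simp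
    then have "M $$ (i, j) = 1 \<longleftrightarrow> N $$ (i, j) = 1"
      using xy by (simp add: mat_support_def)
    moreover have "M $$ (i, j) \<in> {0, 1}" "N $$ (i, j) \<in> {0, 1}"
      using M N ij elements_mat_subset_iff by blast+
    ultimately show "M $$ (i, j) = N $$ (i, j)" by auto
  qed auto
  show "mat_support p q ` ?D = Pow (?A \<times> ?A)"
  proof (intro equalityI subsetI)
    fix E assume E: "E \<in> Pow (?A \<times> ?A)"
    define M :: "'a mat" where
      "M = mat ?n ?n (\<lambda>(i, j). if (the_inv_into ?A ?r i, the_inv_into ?A ?r j) \<in> E then 1 else 0)"
    have "M \<in> carrier_mat ?n ?n" by (simp add: M_def)
    then have "M \<in> ?D" by (simp add: elements_mat_subset_iff) (simp add: M_def)
    moreover have "M $$ (?r x, ?r y) = 1 \<longleftrightarrow> (x, y) \<in> E" if "x \<in> ?A" "y \<in> ?A" for x y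
    proof -
      have "?r x < ?n" "?r y < ?n" using that im by auto
      then show ?thesis using that by (simp add: M_def the_inv_into_f_f[OF inj])
    qed
    then have "mat_support p q M = E" using E by (auto simp: mat_support_def)
    ultimately show "E \<in> mat_support p q ` ?D" by blast
  qed (auto simp: mat_support_def)
qed

lemma card_permutation_matrix_eq_card_matching_on:
  "card {P :: 'a::zero_neq_one mat. permutation_matrix (p * q) P \<and>
      permutation_matrix (p * q) (partial_transpose p q P)} =
   card {E. matching_on (cells p q) E \<and> matching_on (cells p q) (swap_offsets E)}"
proof -
  let ?n = "p * q"
  let ?D = "{M :: 'a mat. M \<in> carrier_mat ?n ?n \<and> elements_mat M \<subseteq> {0, 1}}"
  \<comment> \<open>Every entry of the partial transpose is an entry of \<open>M\<close>, so the
    translation into matchings applies to the partial transpose as well.\<close>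
  have elem: "elements_mat (partial_transpose p q M) \<subseteq> {0, 1}" if M: "M \<in> ?D" for M
  proof -
    have "partial_transpose p q M $$ (i, j) \<in> {0, 1}" if ij: "i < ?n" "j < ?n" for i j
    proof -
      have q: "0 < q" using ij by (auto intro: Nat.gr0I)
      have d: "i div q < p" "j div q < p" using ij by (auto simp: less_mult_imp_div_less)
      have "partial_transpose p q M $$ (i, j) = M $$ (i div q * q + j mod q, j div q * q + i mod q)"
        using partial_transpose_index[OF d, of "i mod q" q "j mod q" M] q by simp
      moreover have "i div q * q + j mod q < ?n" "j div q * q + i mod q < ?n"
        using d q by (auto intro!: block_index_less)
      ultimately have "partial_transpose p q M $$ (i, j) \<in> elements_mat M"
        using M by (auto intro: elements_matI)
      then show ?thesis using M by blast
    qed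
    then show ?thesis by (simp add: elements_mat_subset_iff[OF partial_transpose_carrier])
  qed
  have "permutation_matrix ?n P \<and> permutation_matrix ?n (partial_transpose p q P) \<longleftrightarrow>
      P \<in> ?D \<and> matching_on (cells p q) (mat_support p q P) \<and>
      matching_on (cells p q) (swap_offsets (mat_support p q P))" for P :: "'a mat"
  proof (cases "P \<in> ?D")
    case True
    then show ?thesis
      using permutation_matrix_iff_matching_on[of P p q]
        permutation_matrix_iff_matching_on[OF partial_transpose_carrier elem[OF True]]
      by (simp add: mat_support_partial_transpose)
  qed (auto simp: permutation_matrix_def)
  then have "{P :: 'a mat. permutation_matrix ?n P \<and> permutation_matrix ?n (partial_transpose p q P)} =
      {P \<in> ?D. matching_on (cells p q) (mat_support p q P) \<and>
        matching_on (cells p q) (swap_offsets (mat_support p q P))}" by blast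
  \<comment> \<open>Both conditions depend on the support only, so the bijection restricts to the
    matrices that satisfy them.\<close>
  moreover have "bij_betw (mat_support p q) \<dots>
      {E \<in> Pow (cells p q \<times> cells p q). matching_on (cells p q) E \<and> matching_on (cells p q) (swap_offsets E)}"
    by (rule bij_betw_Collect[OF bij_betw_mat_support]) (rule refl)
  ultimately have "card {P :: 'a mat. permutation_matrix ?n P \<and>
        permutation_matrix ?n (partial_transpose p q P)} =
      card {E \<in> Pow (cells p q \<times> cells p q). matching_on (cells p q) E \<and> matching_on (cells p q) (swap_offsets E)}"
    by (simp add: bij_betw_same_card)
  also have "{E \<in> Pow (cells p q \<times> cells p q). matching_on (cells p q) E \<and> matching_on (cells p q) (swap_offsets E)} =
      {E. matching_on (cells p q) E \<and> matching_on (cells p q) (swap_offsets E)}"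
    by (auto simp: matching_on_def)
  finally show ?thesis .
qed

subsection \<open>Decomposition into permutations and offset bijections\<close>

text \<open>The bijections of all blocks, \<open>s \<mapsto> t\<close> in block \<open>(a, f s a)\<close>, are collected into the single
  map \<open>(a, s) \<mapsto> (a, t)\<close>, so that they are counted by \<open>card_inj_fibre_maps\<close>.\<close>

definition offset_maps :: "nat \<Rightarrow> nat \<Rightarrow> (nat \<Rightarrow> nat \<Rightarrow> nat) \<Rightarrow> (nat \<Rightarrow> nat \<Rightarrow> nat) \<Rightarrow> (nat \<times> nat \<Rightarrow> nat \<times> nat) set" where
  "offset_maps p q f g = {\<tau> \<in> cells p q \<rightarrow>\<^sub>E cells p q. inj_on \<tau> (cells p q) \<and>
     (\<forall>x\<in>cells p q. (\<lambda>(a, t). (a, g t a)) (\<tau> x) = (\<lambda>(a, s). (a, f s a)) x)}"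

definition matching_of :: "nat \<Rightarrow> nat \<Rightarrow> ((nat \<Rightarrow> nat \<Rightarrow> nat) \<times> (nat \<Rightarrow> nat \<Rightarrow> nat)) \<times> (nat \<times> nat \<Rightarrow> nat \<times> nat)
    \<Rightarrow> ((nat \<times> nat) \<times> (nat \<times> nat)) set" where
  "matching_of p q = (\<lambda>((f, g), \<tau>).
     {((a, s), (b, t)) | a s b t. (a, s) \<in> cells p q \<and> \<tau> (a, s) = (a, t) \<and> f s a = b})"

lemma in_matching_of [simp]:
  "((a, s), (b, t)) \<in> matching_of p q ((f, g), \<tau>) \<longleftrightarrow>
     (a, s) \<in> cells p q \<and> \<tau> (a, s) = (a, t) \<and> f s a = b"
  by (auto simp: matching_of_def)

lemma offset_mapsD:
  assumes "\<tau> \<in> offset_maps p q f g" "(a, s) \<in> cells p q"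
  obtains t where "\<tau> (a, s) = (a, t)" "t < q" "g t a = f s a"
proof -
  obtain a' t where eq: "\<tau> (a, s) = (a', t)" by (cases "\<tau> (a, s)")
  have "\<tau> (a, s) \<in> cells p q" "(\<lambda>(a, t). (a, g t a)) (\<tau> (a, s)) = (a, f s a)"
    using assms by (auto simp: offset_maps_def)
  then show ?thesis using that eq by auto
qed

lemma offset_maps_eqD:
  assumes "\<tau> \<in> offset_maps p q f g" "(a, s) \<in> cells p q" "\<tau> (a, s) = (a', t)"
  shows "a' = a" "t < q" "g t a = f s a"
  using offset_mapsD[OF assms(1,2)] assms(3) by auto

text \<open>An injective self-map of the finite set of cells is onto, and \<open>\<tau>\<close>
  preserves the block row.\<close>

lemma offset_maps_surjD:
  assumes "\<tau> \<in> offset_maps p q f g" "(a, t) \<in> cells p q"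
  obtains s where "(a, s) \<in> cells p q" "\<tau> (a, s) = (a, t)"
proof -
  have "\<tau> ` cells p q \<subseteq> cells p q" "inj_on \<tau> (cells p q)"
    using assms(1) by (auto simp: offset_maps_def)
  then have "\<tau> ` cells p q = cells p q" by (rule endo_inj_surj[OF finite_cells])
  then obtain a' s where s: "(a', s) \<in> cells p q" "\<tau> (a', s) = (a, t)"
    using assms(2) by (metis imageE surj_pair)
  then have "a' = a" using offset_maps_eqD(1)[OF assms(1)] by blast
  then show ?thesis using that s by blast
qed

lemma permutes_sym_perms: "f \<in> J \<rightarrow>\<^sub>E sym_perms p \<Longrightarrow> s \<in> J \<Longrightarrow> f s permutes {1..p}"
  by (auto simp: sym_perms_def)

lemma permutes_ex1_preimage:
  assumes "\<pi> permutes I" "b \<in> I"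
  obtains a where "a \<in> I" "\<pi> a = b" "\<forall>c. \<pi> c = b \<longrightarrow> c = a"
proof -
  have "b \<in> \<pi> ` I" using assms(2) permutes_image[OF assms(1)] by simp
  then obtain a where a: "a \<in> I" "\<pi> a = b" by blast
  then have "\<forall>c. \<pi> c = b \<longrightarrow> c = a" using injD[OF permutes_inj[OF assms(1)]] by metis
  then show ?thesis using that a by blast
qed

text \<open>Four uniqueness conditions are checked. Rows of \<open>E\<close> are unique since
  \<open>\<tau>\<close> is a function, rows of the swapped set since \<open>\<tau>\<close> is a
  bijection. In a column \<open>(b, t)\<close> of \<open>E\<close> the permutation
  \<open>g t\<close> determines \<open>a\<close>, and then \<open>\<tau>\<close> determines
  \<open>s\<close>; in a column \<open>(b, s)\<close> of the swapped set \<open>f s\<close>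
  determines \<open>a\<close>, and then \<open>\<tau>\<close> determines \<open>t\<close>.\<close>

lemma matching_of_is_matching:
  assumes f: "f \<in> {..<q} \<rightarrow>\<^sub>E sym_perms p" and g: "g \<in> {..<q} \<rightarrow>\<^sub>E sym_perms p"
    and \<tau>: "\<tau> \<in> offset_maps p q f g"
  defines "E \<equiv> matching_of p q ((f, g), \<tau>)"
  shows "matching_on (cells p q) E" and "matching_on (cells p q) (swap_offsets E)"
proof -
  have inE: "((a, s), (b, t)) \<in> E \<longleftrightarrow> (a, s) \<in> cells p q \<and> \<tau> (a, s) = (a, t) \<and> f s a = b" for a s b t
    by (simp add: E_def)
  have inj: "s = s'" if "(a, s) \<in> cells p q" "(a, s') \<in> cells p q" "\<tau> (a, s) = \<tau> (a, s')" for a s s'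
    using \<tau> that by (auto simp: offset_maps_def dest: inj_onD)
  have E2: "t < q \<and> g t a = b \<and> b \<in> {1..p}" if "((a, s), (b, t)) \<in> E" for a s b t
    using that offset_mapsD[OF \<tau>, of a s] permutes_in_image[OF permutes_sym_perms[OF f, of s], of a]
    by (auto simp: inE)
  have sub: "E \<subseteq> cells p q \<times> cells p q"
    using E2 inE by fastforce
  have sub': "swap_offsets E \<subseteq> cells p q \<times> cells p q"
    using sub by (auto simp: swap_offsets_def)
  have row: "\<exists>!y. ((a, s), y) \<in> E" if as: "(a, s) \<in> cells p q" for a s
  proof -
    obtain t where "\<tau> (a, s) = (a, t)" using offset_mapsD[OF \<tau> as] .
    then have "((a, s), y) \<in> E \<longleftrightarrow> y = (f s a, t)" for y using as by (cases y) (auto simp: inE)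
    then show ?thesis by simp
  qed
  have col: "\<exists>!x. (x, (b, t)) \<in> E" if bt: "(b, t) \<in> cells p q" for b t
  proof -
    have t: "t \<in> {..<q}" and b: "b \<in> {1..p}" using bt by auto
    obtain a where a: "a \<in> {1..p}" "g t a = b" "\<forall>c. g t c = b \<longrightarrow> c = a"
      using permutes_ex1_preimage[OF permutes_sym_perms[OF g t] b] .
    have "(a, t) \<in> cells p q" using a(1) t by simp
    then obtain s where s: "(a, s) \<in> cells p q" "\<tau> (a, s) = (a, t)"
      by (rule offset_maps_surjD[OF \<tau>])
    show ?thesis
    proof (rule ex1I[of _ "(a, s)"])
      have "f s a = b" using offset_maps_eqD(3)[OF \<tau> s] a(2) by simp
      then show "((a, s), (b, t)) \<in> E" using s by (simp add: inE)
    next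
      fix x assume x: "(x, (b, t)) \<in> E"
      obtain a' s' where eq: "x = (a', s')" by (cases x)
      have "a' = a" using E2[of a' s' b t] a(3) x eq by simp
      then show "x = (a, s)" using x inj[OF _ s(1)] s(2) by (simp add: eq inE)
    qed
  qed
  have row': "\<exists>!y. ((a, t), y) \<in> swap_offsets E" if at: "(a, t) \<in> cells p q" for a t
  proof -
    obtain s where s: "(a, s) \<in> cells p q" "\<tau> (a, s) = (a, t)" using offset_maps_surjD[OF \<tau> at] .
    have "((a, t), y) \<in> swap_offsets E \<longleftrightarrow> y = (f s a, s)" for y
      using s inj[OF _ s(1)] by (cases y) (auto simp: inE)
    then show ?thesis by simp
  qed
  have col': "\<exists>!x. (x, (b, s)) \<in> swap_offsets E" if bs: "(b, s) \<in> cells p q" for b s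
  proof -
    have s: "s \<in> {..<q}" and b: "b \<in> {1..p}" using bs by auto
    obtain a where a: "a \<in> {1..p}" "f s a = b" "\<forall>c. f s c = b \<longrightarrow> c = a"
      using permutes_ex1_preimage[OF permutes_sym_perms[OF f s] b] .
    have as: "(a, s) \<in> cells p q" using a(1) s by simp
    obtain t where t: "\<tau> (a, s) = (a, t)" using offset_mapsD[OF \<tau> as] .
    have f_iff: "f s c = b \<longleftrightarrow> c = a" for c using a(2,3) by blast
    have "(x, (b, s)) \<in> swap_offsets E \<longleftrightarrow> x = (a, t)" for x
      using t as by (cases x) (auto simp: inE f_iff)
    then show ?thesis by simp
  qed
  show "matching_on (cells p q) E"
    unfolding matching_on_def using sub row col by (simp add: split_paired_all)
  show "matching_on (cells p q) (swap_offsets E)"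
    unfolding matching_on_def using sub' row' col' by (simp add: split_paired_all)
qed

section \<open>Recovering permutations and offset bijections from a matching\<close>

text \<open>For a fixed offset \<open>s\<close>, let \<open>f s\<close> send \<open>a\<close> to the
  block column of the entry in row \<open>(a, s)\<close>. Column uniqueness in the swapped set makes
  \<open>f s\<close> injective, hence a permutation of the finite set \<open>{1..p}\<close>.\<close>

lemma ex_row_permutations:
  assumes E: "matching_on (cells p q) E" and E': "matching_on (cells p q) (swap_offsets E)"
  obtains f where "f \<in> {..<q} \<rightarrow>\<^sub>E sym_perms p" "\<forall>a s b t. ((a, s), (b, t)) \<in> E \<longrightarrow> f s a = b"
proof -
  obtain y where "\<forall>x\<in>cells p q. (x, y x) \<in> E"
    using bchoice[of "cells p q" "\<lambda>x y. (x, y) \<in> E"] matching_on_row[OF E] by blast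
  then have y: "(x, y x) \<in> E" if "x \<in> cells p q" for x using that by blast
  \<comment> \<open>The identity outside \<open>{1..p}\<close> is required by
    \<open>permutes\<close>, and the restriction to \<open>{..<q}\<close> by the extensional
    function space.\<close>
  define f where "f = (\<lambda>s\<in>{..<q}. \<lambda>a. if a \<in> {1..p} then fst (y (a, s)) else a)"
  have eq: "f s a = b" if "((a, s), (b, t)) \<in> E" for a s b t
  proof -
    have as: "(a, s) \<in> cells p q" using matching_on_mem(1)[OF E that] .
    have "y (a, s) = (b, t)" using matching_on_right_unique[OF E y[OF as] that] .
    then show ?thesis using as by (simp add: f_def)
  qed
  have "f s permutes {1..p}" if s: "s < q" for s
  proof (rule bij_imp_permutes)
    have ex: "\<exists>b t. ((a, s), (b, t)) \<in> E" if "a \<in> {1..p}" for a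
      using y[of "(a, s)"] that s by (cases "y (a, s)") auto
    have "f s ` {1..p} \<subseteq> {1..p}"
    proof (rule image_subsetI)
      fix a assume "a \<in> {1..p}"
      then obtain b t where bt: "((a, s), (b, t)) \<in> E" using ex by blast
      then have "(b, t) \<in> cells p q" using matching_on_mem(2)[OF E] by blast
      then show "f s a \<in> {1..p}" using eq[OF bt] by simp
    qed
    moreover have "inj_on (f s) {1..p}"
    proof (rule inj_onI)
      fix a a' assume "a \<in> {1..p}" "a' \<in> {1..p}" and same: "f s a = f s a'"
      then obtain b t b' t' where bt: "((a, s), (b, t)) \<in> E" "((a', s), (b', t')) \<in> E" using ex by blast
      then have "b' = b" using same eq[OF bt(1)] eq[OF bt(2)] by simp
      \<comment> \<open>After swapping, both entries sit in the same column
        \<open>(b, s)\<close>.\<close>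
      then have "((a, t), (b, s)) \<in> swap_offsets E" "((a', t'), (b, s)) \<in> swap_offsets E" using bt by auto
      then have "(a, t) = (a', t')" by (rule matching_on_left_unique[OF E'])
      then show "a = a'" by simp
    qed
    ultimately show "bij_betw (f s) {1..p} {1..p}"
      by (simp add: bij_betw_def endo_inj_surj)
  qed (use s in \<open>auto simp: f_def\<close>)
  then have "f \<in> {..<q} \<rightarrow>\<^sub>E sym_perms p" by (auto simp: sym_perms_def f_def)
  then show ?thesis using that eq by blast
qed

text \<open>The entries of the matching reveal \<open>f\<close> and \<open>\<tau>\<close> directly,
  and \<open>g\<close> through the surjectivity of \<open>\<tau>\<close>. Conversely,
  \<open>f\<close> comes from the given matching, \<open>g\<close> from its swapped version, and
  \<open>\<tau>\<close> from the offsets of the entries.\<close>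

lemma bij_betw_matching_of:
  "bij_betw (matching_of p q)
     (SIGMA fg : ({..<q} \<rightarrow>\<^sub>E sym_perms p) \<times> ({..<q} \<rightarrow>\<^sub>E sym_perms p). offset_maps p q (fst fg) (snd fg))
     {E. matching_on (cells p q) E \<and> matching_on (cells p q) (swap_offsets E)}"
proof (rule bij_betw_imageI)
  let ?F = "{..<q} \<rightarrow>\<^sub>E sym_perms p"
  let ?T = "SIGMA fg : ?F \<times> ?F. offset_maps p q (fst fg) (snd fg)"
  show "inj_on (matching_of p q) ?T"
  proof (rule inj_onI)
    fix u v assume "u \<in> ?T" "v \<in> ?T" and same: "matching_of p q u = matching_of p q v"
    then obtain f g \<tau> f' g' \<tau>' where u: "u = ((f, g), \<tau>)" and v: "v = ((f', g'), \<tau>')"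
      and f: "f \<in> ?F" "f' \<in> ?F" and g: "g \<in> ?F" "g' \<in> ?F"
      and \<tau>: "\<tau> \<in> offset_maps p q f g" "\<tau>' \<in> offset_maps p q f' g'"
      by (cases u, cases v) auto
    have eq: "matching_of p q ((f, g), \<tau>) = matching_of p q ((f', g'), \<tau>')"
      using same unfolding u v .
    have pw: "f' s a = f s a \<and> \<tau>' (a, s) = \<tau> (a, s)" if as: "(a, s) \<in> cells p q" for a s
    proof -
      obtain t where t: "\<tau> (a, s) = (a, t)" using offset_mapsD[OF \<tau>(1) as] .
      then have "((a, s), (f s a, t)) \<in> matching_of p q ((f', g'), \<tau>')"
        unfolding eq[symmetric] using as by simp
      then show ?thesis using t by simp
    qed
    have "f s = f' s" if "s \<in> {..<q}" for s
    proof
      fix a show "f s a = f' s a"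
        using pw[of a s] that permutes_not_in[OF permutes_sym_perms[OF f(1) that], of a]
          permutes_not_in[OF permutes_sym_perms[OF f(2) that], of a]
        by (cases "a \<in> {1..p}") auto
    qed
    then have "f = f'" by (rule PiE_ext[OF f])
    \<comment> \<open>Each \<open>(a, t)\<close> is some \<open>\<tau> (a, s)\<close>, where
      \<open>g t a = f s a\<close>; so agreement of \<open>f\<close> and \<open>\<tau>\<close> with
      their counterparts forces agreement of \<open>g\<close>.\<close>
    moreover have "g t = g' t" if t: "t \<in> {..<q}" for t
    proof
      fix a show "g t a = g' t a"
      proof (cases "a \<in> {1..p}")
        case True
        then have "(a, t) \<in> cells p q" using t by simp
        then obtain s where s: "(a, s) \<in> cells p q" "\<tau> (a, s) = (a, t)"
          using offset_maps_surjD[OF \<tau>(1)] by blast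
        then have "\<tau>' (a, s) = (a, t)" using pw by simp
        then show ?thesis
          using offset_maps_eqD(3)[OF \<tau>(1) s] offset_maps_eqD(3)[OF \<tau>(2) s(1)] pw[OF s(1)] by simp
      next
        case False
        then show ?thesis
          using permutes_not_in[OF permutes_sym_perms[OF g(1) t]] permutes_not_in[OF permutes_sym_perms[OF g(2) t]]
          by simp
      qed
    qed
    then have "g = g'" by (rule PiE_ext[OF g])
    moreover have "\<tau> = \<tau>'"
    proof (rule PiE_ext)
      show "\<tau> \<in> cells p q \<rightarrow>\<^sub>E cells p q" "\<tau>' \<in> cells p q \<rightarrow>\<^sub>E cells p q"
        using \<tau> by (simp_all add: offset_maps_def)
    qed (use pw in \<open>auto simp only: split_paired_all\<close>)
    ultimately show "u = v" unfolding u v by simp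
  qed
  show "matching_of p q ` ?T = {E. matching_on (cells p q) E \<and> matching_on (cells p q) (swap_offsets E)}"
  proof (intro equalityI subsetI)
    fix E assume "E \<in> matching_of p q ` ?T"
    then obtain f g \<tau> where "f \<in> ?F" "g \<in> ?F" "\<tau> \<in> offset_maps p q f g" "E = matching_of p q ((f, g), \<tau>)"
      by auto
    then show "E \<in> {E. matching_on (cells p q) E \<and> matching_on (cells p q) (swap_offsets E)}"
      using matching_of_is_matching by simp
  next
    fix E assume "E \<in> {E. matching_on (cells p q) E \<and> matching_on (cells p q) (swap_offsets E)}"
    then have E: "matching_on (cells p q) E" and E': "matching_on (cells p q) (swap_offsets E)" by auto
    obtain f where f: "f \<in> ?F" and f_E: "\<forall>a s b t. ((a, s), (b, t)) \<in> E \<longrightarrow> f s a = b"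
      by (rule ex_row_permutations[OF E E'])
    obtain g where g: "g \<in> ?F" and g_E: "\<forall>a s b t. ((a, s), (b, t)) \<in> swap_offsets E \<longrightarrow> g s a = b"
      \<comment> \<open>The situation is symmetric: swapping twice gives back \<open>E\<close>, so
        the same lemma applies with the two matchings exchanged.\<close>
      by (rule ex_row_permutations[OF E', unfolded swap_offsets_swap_offsets, OF E])
    obtain y where "\<forall>x\<in>cells p q. (x, y x) \<in> E"
      using bchoice[of "cells p q" "\<lambda>x y. (x, y) \<in> E"] matching_on_row[OF E] by blast
  then have y: "(x, y x) \<in> E" if "x \<in> cells p q" for x using that by blast
    define \<tau> where "\<tau> = (\<lambda>(a, s)\<in>cells p q. (a, snd (y (a, s))))"
    have sub: "(a, s) \<in> cells p q" "(b, t) \<in> cells p q" if "((a, s), (b, t)) \<in> E" for a s b t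
      using matching_on_mem[OF E that] .
    have tau: "\<tau> (a, s) = (a, t)" if "((a, s), (b, t)) \<in> E" for a s b t
      using matching_on_right_unique[OF E y that] sub(1)[OF that] by (simp add: \<tau>_def)
    have ex: "\<exists>b t. ((a, s), (b, t)) \<in> E" if "(a, s) \<in> cells p q" for a s
      using y[OF that] by (cases "y (a, s)") auto
    have "\<tau> \<in> cells p q \<rightarrow>\<^sub>E cells p q"
    proof (rule PiE_I)
      fix x assume x: "x \<in> cells p q"
      obtain a s where x_eq: "x = (a, s)" by (cases x)
      obtain b t where bt: "((a, s), (b, t)) \<in> E" using ex[OF x[unfolded x_eq]] by blast
      show "\<tau> x \<in> cells p q" using tau[OF bt] sub[OF bt] by (simp add: x_eq)
    qed (simp add: \<tau>_def)
    moreover have "inj_on \<tau> (cells p q)"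
    proof (rule inj_onI, clarify)
      fix a s a' s' assume "(a, s) \<in> cells p q" "(a', s') \<in> cells p q" and same: "\<tau> (a, s) = \<tau> (a', s')"
      then obtain b t b' t' where bt: "((a, s), (b, t)) \<in> E" "((a', s'), (b', t')) \<in> E" using ex by blast
      then have "a' = a" "t' = t" using same tau[OF bt(1)] tau[OF bt(2)] by simp_all
      \<comment> \<open>Both entries lie in row \<open>(a, t)\<close> of the swapped set, so they
        share their column and in particular the offset \<open>s\<close>.\<close>
      then have "((a, t), (b, s)) \<in> swap_offsets E" "((a, t), (b', s')) \<in> swap_offsets E" using bt by auto
      then have "(b, s) = (b', s')" by (rule matching_on_right_unique[OF E'])
      then show "a = a' \<and> s = s'" using \<open>a' = a\<close> by simp
    qed
    moreover have "(\<lambda>(a, t). (a, g t a)) (\<tau> x) = (\<lambda>(a, s). (a, f s a)) x" if x: "x \<in> cells p q" for x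
    proof -
      obtain a s where x_eq: "x = (a, s)" by (cases x)
      obtain b t where bt: "((a, s), (b, t)) \<in> E" using ex[OF x[unfolded x_eq]] by blast
      \<comment> \<open>One entry read in both ways: its block column is \<open>f s a\<close> in
        \<open>E\<close> and \<open>g t a\<close> in the swapped set.\<close>
      then have "((a, t), (b, s)) \<in> swap_offsets E" by simp
      then have "g t a = b" using g_E by blast
      then show ?thesis using tau[OF bt] f_E[rule_format, OF bt] by (simp add: x_eq)
    qed
    ultimately have "\<tau> \<in> offset_maps p q f g" by (simp add: offset_maps_def)
    then have "((f, g), \<tau>) \<in> ?T" using f g by simp
    moreover have "matching_of p q ((f, g), \<tau>) = E"
    proof -
      have "((a, s), (b, t)) \<in> matching_of p q ((f, g), \<tau>) \<longleftrightarrow> ((a, s), (b, t)) \<in> E" for a s b t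
      proof
        assume "((a, s), (b, t)) \<in> matching_of p q ((f, g), \<tau>)"
        then have h: "(a, s) \<in> cells p q" "\<tau> (a, s) = (a, t)" "f s a = b" by auto
        then obtain b' t' where bt: "((a, s), (b', t')) \<in> E" using ex by blast
        then show "((a, s), (b, t)) \<in> E" using h tau[OF bt] f_E[rule_format, OF bt] by simp
      next
        assume bt: "((a, s), (b, t)) \<in> E"
        then show "((a, s), (b, t)) \<in> matching_of p q ((f, g), \<tau>)"
          unfolding in_matching_of using tau[OF bt] f_E[rule_format, OF bt] sub(1)[OF bt] by blast
      qed
      then show ?thesis by auto
    qed
    ultimately show "E \<in> matching_of p q ` ?T" by (intro image_eqI[of _ _ "((f, g), \<tau>)"]) simp_all
  qed
qed

subsection \<open>Counting by multiplicities\<close>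

text \<open>The restriction to \<open>sym_perms p\<close> puts the counts into the extensional space
  of families used by \<open>admissible_families\<close>.\<close>

definition perm_counts :: "nat \<Rightarrow> nat \<Rightarrow> (nat \<Rightarrow> nat \<Rightarrow> nat) \<Rightarrow> (nat \<Rightarrow> nat) \<Rightarrow> nat" where
  "perm_counts p q f = (\<lambda>\<pi>\<in>sym_perms p. card {s \<in> {..<q}. f s = \<pi>})"

lemma sum_card_fibres:
  assumes "finite A" "finite B" "f ` A \<subseteq> B"
  shows "(\<Sum>y\<in>B. card {x \<in> A. f x = y}) = card A"
  using sum.group[OF assms, of "\<lambda>_. 1 :: nat"] by simp

lemma sum_perm_counts:
  assumes "f \<in> {..<q} \<rightarrow>\<^sub>E sym_perms p"
  shows "(\<Sum>\<pi>\<in>sym_perms p. perm_counts p q f \<pi>) = q"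
proof -
  have "(\<Sum>\<pi>\<in>sym_perms p. perm_counts p q f \<pi>) = (\<Sum>\<pi>\<in>sym_perms p. card {s \<in> {..<q}. f s = \<pi>})"
    by (intro sum.cong) (simp_all add: perm_counts_def)
  also have "\<dots> = card {..<q}"
    using assms by (intro sum_card_fibres finite_sym_perms) auto
  finally show ?thesis by simp
qed

text \<open>The offsets \<open>s\<close> with \<open>f s i = j\<close> are grouped by the
  permutation \<open>f s\<close>.\<close>

lemma marginal_perm_counts:
  assumes "f \<in> {..<q} \<rightarrow>\<^sub>E sym_perms p"
  shows "marginal p (perm_counts p q f) i j = card {s \<in> {..<q}. f s i = j}"
proof -
  let ?S = "{\<pi> \<in> sym_perms p. \<pi> i = j}" and ?A = "{s \<in> {..<q}. f s i = j}"
  have "marginal p (perm_counts p q f) i j = (\<Sum>\<pi>\<in>?S. card {s \<in> ?A. f s = \<pi>})"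
    unfolding marginal_def
    by (intro sum.cong) (auto simp: perm_counts_def intro!: arg_cong[of _ _ card])
  also have "\<dots> = card ?A"
    using assms finite_sym_perms by (intro sum_card_fibres) auto
  finally show ?thesis .
qed

text \<open>The pair \<open>(a, f s a)\<close> names the block that receives the entry of row
  \<open>(a, s)\<close>, so the marginal at \<open>(i, j)\<close> is the number of ones in block
  \<open>(i, j)\<close>.\<close>

lemma card_cells_fibre:
  assumes "i \<in> {1..p}" "f \<in> {..<q} \<rightarrow>\<^sub>E sym_perms p"
  shows "card {x \<in> cells p q. (\<lambda>(a, s). (a, f s a)) x = (i, j)} = marginal p (perm_counts p q f) i j"
proof -
  have "{x \<in> cells p q. (\<lambda>(a, s). (a, f s a)) x = (i, j)} = Pair i ` {s \<in> {..<q}. f s i = j}"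
    using assms(1) by auto
  then show ?thesis
    by (simp add: card_image inj_on_def marginal_perm_counts[OF assms(2)])
qed

text \<open>Each block carries a bijection between its row offsets, counted by \<open>f\<close>, and
  its column offsets, counted by \<open>g\<close>. Equal marginals give one factorial per block; any
  mismatch rules out every \<open>\<tau>\<close>.\<close>

lemma card_offset_maps:
  assumes f: "f \<in> {..<q} \<rightarrow>\<^sub>E sym_perms p" and g: "g \<in> {..<q} \<rightarrow>\<^sub>E sym_perms p"
  shows "card (offset_maps p q f g) =
    (if \<forall>i\<in>{1..p}. \<forall>j\<in>{1..p}. marginal p (perm_counts p q f) i j = marginal p (perm_counts p q g) i j
     then \<Prod>i\<in>{1..p}. \<Prod>j\<in>{1..p}. fact (marginal p (perm_counts p q f) i j) else 0)"
proof (cases "\<forall>i\<in>{1..p}. \<forall>j\<in>{1..p}. marginal p (perm_counts p q f) i j = marginal p (perm_counts p q g) i j")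
  case True
  let ?v = "\<lambda>f (a, s). (a, f s a) :: nat \<times> nat"
  have "card (offset_maps p q f g) =
      (\<Prod>c\<in>{1..p} \<times> {1..p}. fact (card {x \<in> cells p q. ?v f x = c}))"
    unfolding offset_maps_def
  proof (rule card_inj_fibre_maps)
    have "f s a \<in> {1..p}" if "(a, s) \<in> cells p q" for a s
      using that permutes_in_image[OF permutes_sym_perms[OF f, of s], of a] by simp
    then show "?v f ` cells p q \<subseteq> {1..p} \<times> {1..p}" by (auto simp del: atLeastAtMost_iff) simp_all
    fix c assume c: "c \<in> {1..p} \<times> {1..p}"
    then obtain i j where "c = (i, j)" "i \<in> {1..p}" "j \<in> {1..p}" by blast
    then show "card {x \<in> cells p q. ?v f x = c} = card {y \<in> cells p q. ?v g y = c}"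
      using card_cells_fibre[OF _ f] card_cells_fibre[OF _ g] True by simp
  qed (simp_all add: finite_cells)
  also have "\<dots> = (\<Prod>i\<in>{1..p}. \<Prod>j\<in>{1..p}. fact (card {x \<in> cells p q. ?v f x = (i, j)}))"
    by (simp only: prod.cartesian_product case_prod_unfold prod.collapse)
  also have "\<dots> = (\<Prod>i\<in>{1..p}. \<Prod>j\<in>{1..p}. fact (marginal p (perm_counts p q f) i j))"
    by (intro prod.cong refl arg_cong[of _ _ fact] card_cells_fibre f)
  finally show ?thesis using True by simp
next
  case False
  have "offset_maps p q f g = {}"
  proof (rule ccontr)
    assume "offset_maps p q f g \<noteq> {}"
    then obtain \<tau> where \<tau>: "\<tau> \<in> offset_maps p q f g" by blast
    have "marginal p (perm_counts p q f) i j = marginal p (perm_counts p q g) i j" if i: "i \<in> {1..p}" for i j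
    proof -
      let ?A = "{x \<in> cells p q. (\<lambda>(a, s). (a, f s a)) x = (i, j)}"
      let ?B = "{x \<in> cells p q. (\<lambda>(a, s). (a, g s a)) x = (i, j)}"
      \<comment> \<open>A single \<open>\<tau>\<close> already matches the \<open>f\<close>-fibre
        over \<open>(i, j)\<close> with the \<open>g\<close>-fibre, which forces equal
        marginals.\<close>
      have "\<tau> ` ?A = ?B"
      proof (intro equalityI subsetI)
        fix y assume "y \<in> \<tau> ` ?A"
        then obtain a s where as: "(a, s) \<in> cells p q" "a = i" "f s a = j" "y = \<tau> (a, s)" by auto
        obtain t where "\<tau> (a, s) = (a, t)" "t < q" "g t a = f s a"
          using offset_mapsD[OF \<tau> as(1)] .
        then show "y \<in> ?B" using as by simp
      next
        fix y assume y: "y \<in> ?B"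
        obtain a t where y_eq: "y = (a, t)" by (cases y)
        then have at: "(a, t) \<in> cells p q" "a = i" "g t a = j" using y by auto
        obtain s where s: "(a, s) \<in> cells p q" "\<tau> (a, s) = (a, t)"
          using offset_maps_surjD[OF \<tau> at(1)] .
        then have "f s a = j" using offset_maps_eqD(3)[OF \<tau> s] at(3) by simp
        then have mem: "(a, s) \<in> ?A" using s(1) at(2) by simp
        have "y = \<tau> (a, s)" using s(2) y_eq by simp
        then show "y \<in> \<tau> ` ?A" using mem by (rule image_eqI)
      qed
      moreover have "inj_on \<tau> (cells p q)" using \<tau> by (simp add: offset_maps_def)
      then have "inj_on \<tau> ?A" by (rule inj_on_subset) blast
      ultimately have "card ?A = card ?B" using card_image[of \<tau> ?A] by simp
      then show ?thesis by (simp only: card_cells_fibre[OF i f] card_cells_fibre[OF i g])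
    qed
    then show False using False by blast
  qed
  then show ?thesis using False by simp
qed

text \<open>Extensionality and total \<open>q\<close> hold for all counts, so only the marginal
  condition remains.\<close>

lemma admissible_perm_counts_iff:
  assumes "f \<in> {..<q} \<rightarrow>\<^sub>E sym_perms p" "g \<in> {..<q} \<rightarrow>\<^sub>E sym_perms p"
  shows "(perm_counts p q f, perm_counts p q g) \<in> admissible_families p q \<longleftrightarrow>
    (\<forall>i\<in>{1..p}. \<forall>j\<in>{1..p}. marginal p (perm_counts p q f) i j = marginal p (perm_counts p q g) i j)"
proof -
  have "perm_counts p q h \<in> sym_perms p \<rightarrow>\<^sub>E UNIV" for h
    by (simp add: perm_counts_def)
  then show ?thesis
    unfolding admissible_families_def using sum_perm_counts[OF assms(1)] sum_perm_counts[OF assms(2)] by simp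
qed

lemma card_perm_counts_eq:
  assumes "a \<in> sym_perms p \<rightarrow>\<^sub>E UNIV" "(\<Sum>\<pi>\<in>sym_perms p. a \<pi>) = q"
  shows "real (card {f \<in> {..<q} \<rightarrow>\<^sub>E sym_perms p. perm_counts p q f = a}) =
    fact q / (\<Prod>\<pi>\<in>sym_perms p. fact (a \<pi>))"
proof -
  have "perm_counts p q f = a \<longleftrightarrow> (\<forall>\<pi>\<in>sym_perms p. card {s \<in> {..<q}. f s = \<pi>} = a \<pi>)" for f
  proof
    assume "\<forall>\<pi>\<in>sym_perms p. card {s \<in> {..<q}. f s = \<pi>} = a \<pi>"
    then show "perm_counts p q f = a"
      using assms(1) by (intro extensionalityI[of _ "sym_perms p"]) (auto simp: perm_counts_def PiE_iff)
  qed (auto simp: perm_counts_def)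
  then show ?thesis
    using card_maps_with_fibre_sizes[OF finite_sym_perms assms(2)] by simp
qed

section \<open>Assembling the formula\<close>

theorem theorem1:
  fixes p q :: nat
  assumes "p \<ge> 1" and "q \<ge> 1"
  shows "real (card {P :: int mat. permutation_matrix (p * q) P \<and>
                       permutation_matrix (p * q) (partial_transpose p q P)}) =
    (\<Sum>(a, b) \<in> admissible_families p q.
       (fact q)\<^sup>2 / (\<Prod>\<pi>\<in>sym_perms p. fact (a \<pi>) * fact (b \<pi>)) *
       (\<Prod>i\<in>{1..p}. \<Prod>j\<in>{1..p}. fact (marginal p a i j)))"
proof -
  let ?F = "{..<q} \<rightarrow>\<^sub>E sym_perms p" and ?adm = "admissible_families p q"
  let ?c = "map_prod (perm_counts p q) (perm_counts p q)"
  let ?w = "\<lambda>ab. \<Prod>i\<in>{1..p}. \<Prod>j\<in>{1..p}. fact (marginal p (fst ab) i j) :: real"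
  let ?G = "{fg \<in> ?F \<times> ?F. ?c fg \<in> ?adm}"
  have fin_F: "finite ?F" by (intro finite_PiE finite_sym_perms) simp
  have fin_off: "finite (offset_maps p q f g)" for f g
    using finite_PiE[of "cells p q" "\<lambda>_. cells p q"] finite_cells
    by (auto simp: offset_maps_def intro: finite_subset)
  have "real (card {P :: int mat. permutation_matrix (p * q) P \<and>
                       permutation_matrix (p * q) (partial_transpose p q P)}) =
      real (card (SIGMA fg : ?F \<times> ?F. offset_maps p q (fst fg) (snd fg)))"
    unfolding card_permutation_matrix_eq_card_matching_on
    using bij_betw_same_card[OF bij_betw_matching_of] by simp
  also have "\<dots> = (\<Sum>fg\<in>?F \<times> ?F. real (card (offset_maps p q (fst fg) (snd fg))))"
    using fin_F fin_off by (subst card_SigmaI) auto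
  \<comment> \<open>The number of offset maps depends on \<open>f\<close> and \<open>g\<close> only
    through their counts, and it vanishes for inadmissible counts.\<close>
  also have "\<dots> = (\<Sum>fg\<in>?F \<times> ?F. if ?c fg \<in> ?adm then ?w (?c fg) else 0)"
  proof (rule sum.cong[OF refl])
    fix fg assume "fg \<in> ?F \<times> ?F"
    then obtain f g where "fg = (f, g)" "f \<in> ?F" "g \<in> ?F" by blast
    then show "real (card (offset_maps p q (fst fg) (snd fg))) = (if ?c fg \<in> ?adm then ?w (?c fg) else 0)"
      using card_offset_maps[of f q p g] admissible_perm_counts_iff[of f q p g] by simp
  qed
  also have "\<dots> = (\<Sum>fg\<in>?G. ?w (?c fg))"
    using fin_F by (intro sum.mono_neutral_cong_right) auto
  \<comment> \<open>Pairs \<open>(f, g)\<close> are grouped by their pair of counts.\<close>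
  also have "\<dots> = (\<Sum>ab\<in>?adm. real (card {fg \<in> ?G. ?c fg = ab}) * ?w ab)"
    by (rule sum_fun_comp[where f = ?w and g = ?c]) (use fin_F finite_admissible_families in auto)
  also have "\<dots> = (\<Sum>(a, b) \<in> ?adm.
       (fact q)\<^sup>2 / (\<Prod>\<pi>\<in>sym_perms p. fact (a \<pi>) * fact (b \<pi>)) *
       (\<Prod>i\<in>{1..p}. \<Prod>j\<in>{1..p}. fact (marginal p a i j)))"
  proof (rule sum.cong[OF refl], clarify)
    fix a b assume ab: "(a, b) \<in> ?adm"
    let ?N = "\<lambda>a. {f \<in> ?F. perm_counts p q f = a}"
    \<comment> \<open>For an admissible \<open>(a, b)\<close> the membership condition in
      \<open>?G\<close> is automatic, so \<open>f\<close> and \<open>g\<close> vary independently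
      and each contributes a multinomial coefficient.\<close>
    have "{fg \<in> ?G. ?c fg = (a, b)} = ?N a \<times> ?N b"
    proof (rule Set.set_eqI)
      show "fg \<in> {fg \<in> ?G. ?c fg = (a, b)} \<longleftrightarrow> fg \<in> ?N a \<times> ?N b" for fg
        by (cases fg, simp only: mem_Collect_eq mem_Times_iff map_prod_simp fst_conv snd_conv prod.inject)
          (use ab in blast)
    qed
    then have "real (card {fg \<in> ?G. ?c fg = (a, b)}) = real (card (?N a)) * real (card (?N b))"
      by (simp add: card_cartesian_product)
    also have "\<dots> = fact q / (\<Prod>\<pi>\<in>sym_perms p. fact (a \<pi>)) * (fact q / (\<Prod>\<pi>\<in>sym_perms p. fact (b \<pi>)))"
      using ab card_perm_counts_eq[of a p q] card_perm_counts_eq[of b p q] by (simp add: admissible_families_def)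
    also have "\<dots> = (fact q)\<^sup>2 / (\<Prod>\<pi>\<in>sym_perms p. fact (a \<pi>) * fact (b \<pi>))"
      by (simp add: prod.distrib power2_eq_square)
    finally show "real (card {fg \<in> ?G. ?c fg = (a, b)}) * ?w (a, b) =
       (fact q)\<^sup>2 / (\<Prod>\<pi>\<in>sym_perms p. fact (a \<pi>) * fact (b \<pi>)) *
       (\<Prod>i\<in>{1..p}. \<Prod>j\<in>{1..p}. fact (marginal p a i j))"
      by simp
  qed
  finally show ?thesis .
qed

end
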